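(* Any single-pass streaming algorithm that, on an $n$-vertex graph given as an insertion-only stream of edges, outputs a maximal independent set of the graph with probability at least $2/3$ requires $\Omega(n^2)$ bits of space.
   Context: A maximal independent set is an independent set not contained in any strictly larger independent set; the algorithm may output any such set. *)

theory Defs
  imports "HOL-Probability.Probability_Mass_Function"
begin

definition edge_stream :: "nat \<Rightarrow> (nat \<times> nat) list \<Rightarrow> bool" where
  "edge_stream n es \<longleftrightarrow> distinct es \<and>
     (\<forall>(u,v)\<in>set es. u < n \<and> v < n \<and> u \<noteq> v \<and> (v,u) \<notin> set es)"

definition adj :: "(nat \<times> nat) list \<Rightarrow> nat \<Rightarrow> nat \<Rightarrow> bool" where
  "adj es u v \<longleftrightarrow> (u,v) \<in> set es \<or> (v,u) \<in> set es"

definition independent :: "nat \<Rightarrow> (nat \<times> nat) list \<Rightarrow> nat set \<Rightarrow> bool" where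
  "independent n es I \<longleftrightarrow> I \<subseteq> {0..<n} \<and> (\<forall>u\<in>I. \<forall>v\<in>I. \<not> adj es u v)"

definition is_MIS :: "nat \<Rightarrow> (nat \<times> nat) list \<Rightarrow> nat set \<Rightarrow> bool" where
  "is_MIS n es I \<longleftrightarrow> independent n es I \<and> (\<forall>J. independent n es J \<and> I \<subseteq> J \<longrightarrow> J = I)"

definition run_stream :: "nat \<Rightarrow> (nat \<Rightarrow> nat \<times> nat \<Rightarrow> nat) \<Rightarrow> (nat \<times> nat) list \<Rightarrow> nat" where
  "run_stream q0 step es = fold (\<lambda>e q. step q e) es q0"

text \<open>A randomized single-pass streaming algorithm for n-vertex graphs using s bits of memory
  (memory states are 0..2^s-1). The random seed r is drawn from a discrete distribution D
  (randomness is free, which only strengthens a lower bound). It gives an initial state, a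
  transition function per edge, and an output function on the final state. It solves MIS if
  on every valid stream it outputs a maximal independent set with probability at least 2/3.\<close>
definition streaming_MIS_alg ::
  "nat \<Rightarrow> nat \<Rightarrow> nat pmf \<Rightarrow> (nat \<Rightarrow> nat) \<Rightarrow> (nat \<Rightarrow> nat \<Rightarrow> nat \<times> nat \<Rightarrow> nat)
     \<Rightarrow> (nat \<Rightarrow> nat \<Rightarrow> nat set) \<Rightarrow> bool" where
  "streaming_MIS_alg n s D init step out \<longleftrightarrow>
     (\<forall>r. init r < 2 ^ s) \<and>
     (\<forall>r q e. q < 2 ^ s \<longrightarrow> step r q e < 2 ^ s) \<and>
     (\<forall>es. edge_stream n es \<longrightarrow>
        measure_pmf.prob D {r. is_MIS n es (out r (run_stream (init r) (step r) es))} \<ge> 2/3)"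

end

theory Submission
  imports Defs
begin

text \<open>The bound is a reduction from the one-way communication problem INDEX. Alice streams two
  disjoint copies of a bipartite graph \<open>S\<close> of her choice on \<open>k + k\<close> vertices, and Bob, who
  wants to know whether \<open>(u,v)\<close> is an edge of \<open>S\<close>, joins every vertex of the first copy to every
  vertex of the second, except for the copies of \<open>u\<close> and \<open>v\<close>. A maximal independent set then
  reveals the answer: \<open>(u,v)\<close> is a non-edge iff some copy has both \<open>u\<close> and \<open>v\<close> in the set.
  After fixing the best seed, each of the \<open>2^s\<close> memory states is a guess for all of \<open>S\<close>, and
  the guess agrees with \<open>S\<close> on 2/3 of the \<open>N = k^2\<close> pairs on average. For a uniformly random
  \<open>S\<close> and a fixed guess, the mean of \<open>2^agreement\<close> is \<open>(3/2)^N\<close>, so by convexity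
  \<open>2^(2N/3) \<le> 2^s (3/2)^N\<close>.\<close>

section \<open>Agreement of random subsets with few guesses\<close>

text \<open>The weight factorises over \<open>P\<close>: each \<open>p\<close> contributes 2 if
  membership in \<open>S\<close> agrees with \<open>G\<close> and 1 otherwise. Expanding the product
  of the sums \<open>2 + 1\<close> gives exactly the sum over all \<open>S\<close>.\<close>

lemma sum_power_agreement:
  fixes P G :: "'a set"
  assumes "finite P"
  shows "(\<Sum>S\<in>Pow P. (2::real) ^ card {p\<in>P. p \<in> S \<longleftrightarrow> p \<in> G}) = 3 ^ card P"
proof -
  let ?f = "\<lambda>p. if p \<in> G then 2 else (1::real)"
  let ?g = "\<lambda>p. if p \<in> G then 1 else (2::real)"
  have "(2::real) ^ card {p\<in>P. p \<in> S \<longleftrightarrow> p \<in> G} = prod ?f S * prod ?g (P - S)"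
    if "S \<subseteq> P" for S
  proof -
    have fin: "finite S" "finite (P - S)"
      using assms that finite_subset by auto
    have split: "{p\<in>P. p \<in> S \<longleftrightarrow> p \<in> G} = (S \<inter> G) \<union> (P - S - G)"
      using that by blast
    have "card ((S \<inter> G) \<union> (P - S - G)) = card (S \<inter> G) + card (P - S - G)"
      using fin by (intro card_Un_disjoint) auto
    moreover have "prod ?f S = 2 ^ card (S \<inter> G)"
      using fin by (simp add: prod.If_cases Int_def)
    moreover have "prod ?g (P - S) = 2 ^ card (P - S - G)"
      using fin by (simp add: prod.If_cases Diff_eq)
    ultimately show ?thesis
      by (simp add: split power_add)
  qed
  then have "(\<Sum>S\<in>Pow P. (2::real) ^ card {p\<in>P. p \<in> S \<longleftrightarrow> p \<in> G})
      = (\<Sum>S\<in>Pow P. prod ?f S * prod ?g (P - S))"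
    by (intro sum.cong) auto
  also have "\<dots> = (\<Prod>p\<in>P. ?f p + ?g p)"
    using prod_add[OF assms, of ?f ?g] by simp
  also have "\<dots> = (\<Prod>p\<in>P. 3)"
    by (intro prod.cong) auto
  finally show ?thesis
    by simp
qed

text \<open>Here \<open>f\<close> is the message and \<open>g\<close> its decoding. The exponent 5/3
  is 2/3 from the mean agreement plus 1 from the \<open>2 ^ card P\<close> choices of
  \<open>S\<close>.\<close>

lemma index_counting_bound:
  fixes P :: "'a set" and f :: "'a set \<Rightarrow> 'q" and g :: "'q \<Rightarrow> 'a set"
  assumes "finite P" and "finite Q" and f: "\<And>S. S \<subseteq> P \<Longrightarrow> f S \<in> Q"
    and agree: "(\<Sum>S\<in>Pow P. real (card {p\<in>P. p \<in> S \<longleftrightarrow> p \<in> g (f S)}))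
                  \<ge> 2/3 * real (card P) * 2 ^ card P"
  shows "2 powr (5/3 * real (card P)) \<le> real (card Q) * 3 ^ card P"
proof -
  let ?a = "\<lambda>S q. card {p\<in>P. p \<in> S \<longleftrightarrow> p \<in> g q}"
  define A where "A = 2/3 * real (card P)"
  have "A * 2 ^ card P \<le> (\<Sum>S\<in>Pow P. real (?a S (f S)))"
    using agree by (simp add: A_def)
  then have "0 \<le> (\<Sum>S\<in>Pow P. real (?a S (f S)) - A)"
    using assms(1) by (simp add: sum_subtractf card_Pow mult.commute)
  then have "2 powr A * 2 ^ card P
      \<le> 2 powr A * (2 ^ card P + ln 2 * (\<Sum>S\<in>Pow P. real (?a S (f S)) - A))"
    by (intro mult_left_mono) auto
  also have "\<dots> = 2 powr A * (\<Sum>S\<in>Pow P. 1 + ln 2 * (real (?a S (f S)) - A))"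
    using assms(1) by (simp only: sum.distrib sum_distrib_left) (simp add: card_Pow)
  also have "\<dots> = (\<Sum>S\<in>Pow P. 2 powr A * (1 + ln 2 * (real (?a S (f S)) - A)))"
    by (rule sum_distrib_left)
  also have "\<dots> \<le> (\<Sum>S\<in>Pow P. 2 ^ ?a S (f S))"
  proof (rule sum_mono)
    fix S
    \<comment> \<open>the tangent to \<open>2 powr x\<close> at the mean agreement, in place of Jensen's inequality\<close>
    have "1 + ln 2 * (real (?a S (f S)) - A) \<le> 2 powr (real (?a S (f S)) - A)"
      using exp_ge_add_one_self[of "ln 2 * (real (?a S (f S)) - A)"]
      by (simp add: powr_def mult.commute)
    then have "2 powr A * (1 + ln 2 * (real (?a S (f S)) - A))
        \<le> 2 powr A * 2 powr (real (?a S (f S)) - A)"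
      by (intro mult_left_mono) auto
    also have "\<dots> = 2 ^ ?a S (f S)"
      by (simp add: powr_add[symmetric] powr_realpow)
    finally show "2 powr A * (1 + ln 2 * (real (?a S (f S)) - A)) \<le> 2 ^ ?a S (f S)" .
  qed
  \<comment> \<open>Summing over every message makes the guess independent of \<open>S\<close>, at
    the cost of a factor \<open>card Q\<close>.\<close>
  also have "\<dots> \<le> (\<Sum>S\<in>Pow P. \<Sum>q\<in>Q. 2 ^ ?a S q)"
    using assms(2) f by (intro sum_mono member_le_sum) auto
  also have "\<dots> = (\<Sum>q\<in>Q. \<Sum>S\<in>Pow P. 2 ^ ?a S q)"
    by (rule sum.swap)
  also have "\<dots> = real (card Q) * 3 ^ card P"
    using assms(1) by (simp add: sum_power_agreement)
  finally have "2 powr A * 2 ^ card P \<le> real (card Q) * 3 ^ card P" .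
  moreover have "2 powr A * 2 ^ card P = 2 powr (5/3 * real (card P))"
    by (simp add: A_def powr_add[symmetric] powr_realpow[symmetric])
  ultimately show ?thesis
    by simp
qed

section \<open>The hard graphs\<close>

text \<open>Any fixed order serves; it matters only that the list is determined by the set, so that
  Alice's part depends on \<open>S\<close> alone and Bob's on \<open>p\<close> alone.\<close>

definition enum :: "'a set \<Rightarrow> 'a list" where
  "enum X = (SOME xs. set xs = X \<and> distinct xs)"

lemma enum:
  assumes "finite X"
  shows set_enum: "set (enum X) = X" and distinct_enum: "distinct (enum X)"
  using someI_ex[OF finite_distinct_list[OF assms]] by (auto simp: enum_def)

definition doubled :: "nat \<Rightarrow> (nat \<times> nat) set \<Rightarrow> (nat \<times> nat) set" where
  "doubled m S = S \<union> (\<lambda>(i,j). (i + m, j + m)) ` S"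

definition crossing :: "nat \<Rightarrow> nat \<times> nat \<Rightarrow> (nat \<times> nat) set" where
  "crossing m p = (\<lambda>(i,j). (i, j + m)) ` (({..<m} - {fst p, snd p}) \<times> ({..<m} - {fst p, snd p}))"

abbreviation hard_stream :: "nat \<Rightarrow> (nat \<times> nat) set \<Rightarrow> nat \<times> nat \<Rightarrow> (nat \<times> nat) list" where
  "hard_stream m S p \<equiv> enum (doubled m S) @ enum (crossing m p)"

lemma finite_doubled: "finite S \<Longrightarrow> finite (doubled m S)"
  by (simp add: doubled_def)

lemma finite_crossing: "finite (crossing m p)"
  by (simp add: crossing_def)

lemma edge_stream_hard:
  assumes S: "S \<subseteq> {..<k} \<times> {k..<2*k}" and "4 * k \<le> n"
  shows "edge_stream n (hard_stream (2*k) S p)"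
proof -
  have fin: "finite S"
    using S finite_subset by blast
  have set_eq: "set (hard_stream (2*k) S p) = doubled (2*k) S \<union> crossing (2*k) p"
    using fin by (simp add: set_enum finite_doubled finite_crossing)
  have "doubled (2*k) S \<inter> crossing (2*k) p = {}"
    using S by (fastforce simp: doubled_def crossing_def)
  then have "distinct (hard_stream (2*k) S p)"
    using fin by (simp add: distinct_enum set_enum finite_doubled finite_crossing)
  moreover have "\<forall>(u,v)\<in>E. u < n \<and> v < n \<and> u \<noteq> v \<and> (v,u) \<notin> E"
    if E: "E = doubled (2*k) S \<union> crossing (2*k) p" for E
  proof -
    \<comment> \<open>All edges point upwards, which excludes loops and reversed duplicates at
      once.\<close>
    have "u < n \<and> v < n \<and> u < v" if "(u,v) \<in> E" for u v
      using that S assms(2) unfolding E by (fastforce simp: doubled_def crossing_def)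
    then show ?thesis
      unfolding Ball_def split_paired_All prod.case by (metis less_asym)
  qed
  ultimately show ?thesis
    unfolding edge_stream_def set_eq by blast
qed

text \<open>Adding \<open>x\<close> must destroy independence; a stream has no loops, so the
  conflict is with a member of \<open>I\<close>.\<close>

lemma MIS_dominates:
  assumes "edge_stream n es" and "is_MIS n es I" and "x < n" and "x \<notin> I"
  obtains y where "y \<in> I" and "adj es x y"
proof -
  have "\<not> adj es x x"
    using assms(1) by (auto simp: edge_stream_def adj_def)
  moreover have "\<not> independent n es (insert x I)"
    using assms(2,4) by (auto simp: is_MIS_def)
  ultimately show ?thesis
    using assms(2,3) that by (auto simp: is_MIS_def independent_def adj_def)
qed

text \<open>Vertices of different copies are joined unless one is a copy of \<open>u\<close> or \<open>v\<close>, so the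
  set misses one copy outside of \<open>u, v\<close>, and maximality puts both \<open>u\<close> and \<open>v\<close> of that
  copy into the set if they are not adjacent.\<close>
lemma MIS_hard_iff:
  assumes S: "S \<subseteq> {..<k} \<times> {k..<2*k}" and n: "4 * k \<le> n"
    and p: "(u,v) \<in> {..<k} \<times> {k..<2*k}"
    and I: "is_MIS n (hard_stream (2*k) S (u,v)) I"
  shows "(u,v) \<in> S \<longleftrightarrow> \<not> (u \<in> I \<and> v \<in> I \<or> u + 2*k \<in> I \<and> v + 2*k \<in> I)"
proof -
  let ?es = "hard_stream (2*k) S (u,v)"
  have fin: "finite S"
    using S finite_subset by blast
  have set_eq: "set ?es = doubled (2*k) S \<union> crossing (2*k) (u,v)"
    using fin by (simp add: set_enum finite_doubled finite_crossing)
  have indep: "\<not> adj ?es x y" if "x \<in> I" "y \<in> I" for x y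
    using I that by (auto simp: is_MIS_def independent_def)
  note dom = MIS_dominates[OF edge_stream_hard[OF S n] I]
  have uv: "u < k" "k \<le> v" "v < 2*k"
    using p by auto
  show ?thesis
  proof
    assume "(u,v) \<in> S"
    then have "adj ?es u v" "adj ?es (u + 2*k) (v + 2*k)"
      unfolding adj_def set_eq by (auto simp: doubled_def)
    then show "\<not> (u \<in> I \<and> v \<in> I \<or> u + 2*k \<in> I \<and> v + 2*k \<in> I)"
      using indep by blast
  next
    assume neither: "\<not> (u \<in> I \<and> v \<in> I \<or> u + 2*k \<in> I \<and> v + 2*k \<in> I)"
    show "(u,v) \<in> S"
    proof (rule ccontr)
      assume notS: "(u,v) \<notin> S"
      have range: "i < k \<and> k \<le> j \<and> j < 2*k" if "(i,j) \<in> S" for i j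
        using S that by auto
      have nbr: "x < 2*k \<and> x \<noteq> u \<and> x \<noteq> v"
        if "w \<in> {u,v}" "(w,x) \<in> S \<or> (x,w) \<in> S" for w x
        using that notS uv range[of w x] range[of x w] by auto
      have first: "\<exists>x\<in>I. x < 2*k \<and> x \<noteq> u \<and> x \<noteq> v"
      proof -
        obtain w where w: "w \<in> {u,v}" "w \<notin> I"
          using neither by blast
        then have "w < n"
          using uv n by auto
        then obtain y where y: "y \<in> I" "adj ?es w y"
          using dom w by blast
        \<comment> \<open>Crossing edges avoid both copies of \<open>u\<close> and \<open>v\<close>,
          so a neighbour of \<open>w\<close> lies in the same copy.\<close>
        have "(w,y) \<in> S \<or> (y,w) \<in> S"
          using y(2) w(1) uv unfolding adj_def set_eq
          by (auto simp: doubled_def crossing_def)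
        then show ?thesis
          using y nbr[OF w(1)] by blast
      qed
      have second: "\<exists>x. x + 2*k \<in> I \<and> x < 2*k \<and> x \<noteq> u \<and> x \<noteq> v"
      proof -
        obtain w where w: "w \<in> {u,v}" "w + 2*k \<notin> I"
          using neither by blast
        then have "w + 2*k < n"
          using uv n by auto
        then obtain y where y: "y \<in> I" "adj ?es (w + 2*k) y"
          using dom w by blast
        have "\<exists>x. y = x + 2*k \<and> ((w,x) \<in> S \<or> (x,w) \<in> S)"
          using y(2) w(1) uv S unfolding adj_def set_eq
          by (fastforce simp: doubled_def crossing_def)
        then obtain x where x: "y = x + 2*k" "(w,x) \<in> S \<or> (x,w) \<in> S"
          by blast
        then show ?thesis
          using y nbr[OF w(1)] by blast
      qed
      obtain x y where "x \<in> I" "x < 2*k" "x \<noteq> u" "x \<noteq> v"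
          and "y + 2*k \<in> I" "y < 2*k" "y \<noteq> u" "y \<noteq> v"
        using first second by blast
      then have "adj ?es x (y + 2*k)"
        unfolding adj_def set_eq by (auto simp: crossing_def)
      then show False
        using indep \<open>x \<in> I\<close> \<open>y + 2*k \<in> I\<close> by blast
    qed
  qed
qed

section \<open>The space bound\<close>

text \<open>The expected number of events that occur is at least \<open>c * card X\<close>, so some
  outcome attains this. It serves to fix the seed.\<close>

lemma (in prob_space) exists_outcome_many_events:
  assumes "finite X" and "\<And>x. x \<in> X \<Longrightarrow> E x \<in> events" and "\<And>x. x \<in> X \<Longrightarrow> c \<le> prob (E x)"
  shows "\<exists>\<omega>\<in>space M. c * real (card X) \<le> real (card {x\<in>X. \<omega> \<in> E x})"
proof (rule ccontr)
  assume none: "\<not> ?thesis"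
  have count: "real (card {x\<in>X. \<omega> \<in> E x}) = (\<Sum>x\<in>X. indicator (E x) \<omega>)" for \<omega>
    using assms(1) by (simp add: indicator_def sum.If_cases Int_def)
  have int: "integrable M (\<lambda>\<omega>. \<Sum>x\<in>X. indicator (E x) \<omega> :: real)"
    using assms(2) by (intro Bochner_Integration.integrable_sum integrable_real_indicator)
      (auto simp: emeasure_eq_measure)
  have "expectation (\<lambda>\<omega>. \<Sum>x\<in>X. indicator (E x) \<omega>) < c * real (card X)"
    using none int by (intro expectation_less AE_I2) (auto simp: count not_le)
  moreover have "expectation (\<lambda>\<omega>. \<Sum>x\<in>X. indicator (E x) \<omega>) = (\<Sum>x\<in>X. prob (E x))"
    using assms(2)
    by (subst Bochner_Integration.integral_sum)
      (auto simp: emeasure_eq_measure intro!: sum.cong)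
  moreover have "c * real (card X) \<le> (\<Sum>x\<in>X. prob (E x))"
    using sum_mono[of X "\<lambda>_. c" "\<lambda>x. prob (E x)"] assms(3) by (simp add: mult.commute)
  ultimately show False
    by simp
qed

lemma run_stream_append:
  "run_stream q step (xs @ ys) = run_stream (run_stream q step xs) step ys"
  by (simp add: run_stream_def)

lemma run_stream_bound:
  assumes "q < b" and "\<And>q e. q < b \<Longrightarrow> step q e < b"
  shows "run_stream q step es < b"
  using assms(1)
  by (induction es arbitrary: q) (simp_all add: run_stream_def assms(2))

lemma streaming_MIS_states:
  assumes alg: "streaming_MIS_alg n s D init step out" and n: "4 * k \<le> n"
  shows "2 powr (5/3 * real (k^2)) \<le> 2 ^ s * 3 ^ (k^2)"
proof -
  define P where "P = {..<k} \<times> {k..<2*k}"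
  have finP: "finite P" and cardP: "card P = k^2"
    by (auto simp: P_def card_cartesian_product power2_eq_square)
  let ?run = "\<lambda>r q es. run_stream q (step r) es"
  define good where "good = (\<lambda>(S,p). {r. is_MIS n (hard_stream (2*k) S p)
      (out r (?run r (init r) (hard_stream (2*k) S p)))})"
  have good: "2/3 \<le> measure_pmf.prob D (good x)" if "x \<in> Pow P \<times> P" for x
    using that alg edge_stream_hard[OF _ n]
    by (auto simp: good_def streaming_MIS_alg_def P_def)
  obtain r where r: "2/3 * real (card (Pow P \<times> P)) \<le> real (card {x \<in> Pow P \<times> P. r \<in> good x})"
    using measure_pmf.exists_outcome_many_events[of "Pow P \<times> P" good D "2/3"] good finP by auto
  \<comment> \<open>The memory state after Alice's edges is the message; Bob resumes from it once
    for each pair \<open>(u,v)\<close>.\<close>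
  define f where "f S = ?run r (init r) (enum (doubled (2*k) S))" for S
  define g where "g q = {(u,v). let I = out r (?run r q (enum (crossing (2*k) (u,v))))
      in \<not> (u \<in> I \<and> v \<in> I \<or> u + 2*k \<in> I \<and> v + 2*k \<in> I)}" for q
  have correct: "p \<in> S \<longleftrightarrow> p \<in> g (f S)" if "S \<subseteq> P" "p \<in> P" "r \<in> good (S,p)" for S p
  proof -
    obtain u v where p: "p = (u,v)"
      by (cases p)
    show ?thesis
      using MIS_hard_iff[OF _ n, of S u v] that
      by (simp add: p P_def good_def f_def g_def run_stream_append Let_def)
  qed
  have "card {x \<in> Pow P \<times> P. r \<in> good x}
      \<le> card (SIGMA S:Pow P. {p\<in>P. p \<in> S \<longleftrightarrow> p \<in> g (f S)})"
    using finP correct by (intro card_mono) auto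
  also have "\<dots> = (\<Sum>S\<in>Pow P. card {p\<in>P. p \<in> S \<longleftrightarrow> p \<in> g (f S)})"
    using finP by (intro card_SigmaI) auto
  finally have "2/3 * real (card P) * 2 ^ card P
      \<le> (\<Sum>S\<in>Pow P. real (card {p\<in>P. p \<in> S \<longleftrightarrow> p \<in> g (f S)}))"
    using r finP by (simp add: card_cartesian_product card_Pow mult_ac of_nat_sum[symmetric]
        del: of_nat_sum)
  moreover have "f S \<in> {..<2 ^ s}" for S
    using alg unfolding f_def streaming_MIS_alg_def lessThan_iff
    by (intro run_stream_bound) auto
  ultimately have "2 powr (5/3 * real (card P)) \<le> real (card {..<(2::nat) ^ s}) * 3 ^ card P"
    using finP by (intro index_counting_bound[where f = f and g = g]) auto
  then show ?thesis
    by (simp add: cardP)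
qed

theorem mainTheorem9:
  shows "\<exists>c::real. c > 0 \<and> (\<exists>N. \<forall>n\<ge>N. \<forall>s D init step out.
           streaming_MIS_alg n s D init step out \<longrightarrow> real s \<ge> c * real n ^ 2)"
proof (intro exI conjI allI impI)
  define c :: real where "c = 5/3 - log 2 3"
  \<comment> \<open>The bound is nontrivial because 27 < 32, that is,
    \<open>log 2 3 < 5/3\<close>.\<close>
  have "log 2 (3 ^ 3) < log 2 (2 ^ 5 :: real)"
    by (subst log_less_cancel_iff) auto
  then have c: "c > 0"
    by (simp add: c_def log_nat_power del: power_numeral)
  then show "c / 64 > 0"
    by simp
  fix n s :: nat and D init step out
  assume n: "6 \<le> n" and alg: "streaming_MIS_alg n s D init step out"
  define k where "k = n div 4"
  have "2 powr (5/3 * real (k^2)) \<le> 2 ^ s * 3 ^ (k^2)"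
    by (rule streaming_MIS_states[OF alg]) (simp add: k_def)
  then have "log 2 (2 powr (5/3 * real (k^2))) \<le> log 2 (2 ^ s * 3 ^ (k^2))"
    by (subst log_le_cancel_iff) auto
  then have "c * real (k^2) \<le> real s"
    by (simp add: c_def log_mult log_nat_power algebra_simps)
  \<comment> \<open>Rounding in \<open>n div 4\<close> loses at most a factor 2, whence the 64 = 8^2
    in the constant.\<close>
  moreover have "n \<le> 8 * k"
    using n by (simp add: k_def)
  then have "(real n)^2 \<le> (8 * real k)^2"
    by (intro power_mono) auto
  then have "c / 64 * (real n)^2 \<le> c / 64 * (8 * real k)^2"
    using c by (intro mult_left_mono) auto
  ultimately show "c / 64 * real n ^ 2 \<le> real s"
    by (simp add: power_mult_distrib)
qed

end
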